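(* Let $p>3$ be an odd prime, $q=p^e$ with $e\ge 1$, and let $n\ge 0$ be an integer with $3\nmid (n+1)$ and $n\equiv 1\pmod 4$. If $E_n(1,x)$ is a permutation polynomial of $\mathbb{F}_q$, then $\gcd(n+1,q^2-1)=2$.
   Context: $\mathbb{F}_q$ is the finite field with $q$ elements. For an integer $n\ge 0$, the reversed Dickson polynomial of the second kind (with parameter $1$) is $$E_n(1,x):=\sum_{i=0}^{\lfloor n/2\rfloor}\binom{n-i}{i}(-x)^i\in\mathbb{F}_q[x],$$ where the binomial coefficients are interpreted in $\mathbb{F}_q$. A polynomial in $\mathbb{F}_q[x]$ is a permutation polynomial (PP) of $\mathbb{F}_q$ if the map it induces on $\mathbb{F}_q$ is a bijection. *)

theory Defs
  imports "HOL-Computational_Algebra.Computational_Algebra"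
    "HOL-Number_Theory.Cong"
begin

text \<open>The reversed Dickson polynomial of the second kind with parameter 1, usually written
  \<open>E\<^sub>n(1, x)\<close>. The binomial coefficient is a natural number mapped into the
  coefficient ring by \<open>of_nat\<close>; \<open>[:0, 1:]\<close> is the indeterminate.\<close>

definition rev_dickson_snd :: "nat \<Rightarrow> 'a :: comm_ring_1 poly" where
  "rev_dickson_snd n = (\<Sum>i = 0..n div 2. smult (of_nat ((n - i) choose i)) ((- [:0, 1:]) ^ i))"

definition permutation_poly :: "'a :: {field, finite} poly \<Rightarrow> bool" where
  "permutation_poly f \<longleftrightarrow> bij (poly f)"

end

theory Submission
  imports "HOL-Algebra.Algebraic_Closure_Type" "HOL-Number_Theory.Residues" Defs
begin

text \<open>
  Writing \<open>x = a b\<close> with \<open>a + b = 1\<close>, the recurrence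
  \<open>E\<^sub>n\<^sub>+\<^sub>2 = E\<^sub>n\<^sub>+\<^sub>1 - x E\<^sub>n\<close> gives the closed form
  \<open>(a - b) E\<^sub>n(1, x) = a\<^bsup>n+1\<^esup> - b\<^bsup>n+1\<^esup>\<close>
  (lemma \<open>rev_dickson_snd_functional_equation\<close>).  So every \<open>u \<noteq> \<plusminus>1\<close> with
  \<open>u\<^bsup>n+1\<^esup> = 1\<close> produces a root \<open>u / (1 + u)\<^sup>2\<close> of \<open>E\<^sub>n\<close>: take
  \<open>a = u / (1 + u)\<close> and \<open>b = 1 / (1 + u)\<close>, so that \<open>a / b = u\<close>.

  The hypotheses on \<open>n\<close> say that \<open>n + 1\<close> is even, but divisible neither by 4 nor by 3. If the gcd
  differs from 2, it therefore has a prime divisor \<open>l \<ge> 5\<close>.  Let \<open>u \<noteq> 1\<close> be an \<open>l\<close>-th root of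
  unity in an algebraic closure of \<open>\<bbbF>\<^sub>q\<close>.  As \<open>l\<close> divides \<open>q - 1\<close> or \<open>q + 1\<close>, the Frobenius map
  \<open>x \<mapsto> x\<^sup>q\<close> sends \<open>u\<close> to \<open>u\<close> or to \<open>1 / u\<close>; both leave
  \<open>u / (1 + u)\<^sup>2\<close> unchanged, so this root lies in \<open>\<bbbF>\<^sub>q\<close>.  The same is true of \<open>u\<^sup>2\<close> in place of
  \<open>u\<close>.  The two roots agree only if \<open>u\<^sup>2\<close> is \<open>u\<close> or \<open>1 / u\<close>, which \<open>l \<ge> 5\<close> excludes. Hence
  \<open>E\<^sub>n\<close> vanishes at two points of \<open>\<bbbF>\<^sub>q\<close> and is not injective.
\<close>

section \<open>Closed form and roots\<close>

text \<open>The terms with \<open>i > n div 2\<close> vanish. Summing up to \<open>n\<close> makes the range independent of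
  parity, so that Pascal's rule can be applied termwise.\<close>
lemma poly_rev_dickson_snd:
  "poly (rev_dickson_snd n) x = (\<Sum>i\<le>n. of_nat ((n - i) choose i) * (- x) ^ i)"
proof -
  have "poly (rev_dickson_snd n) x = (\<Sum>i\<in>{0..n div 2}. of_nat ((n - i) choose i) * (- x) ^ i)"
    by (simp add: rev_dickson_snd_def poly_sum)
  also have "\<dots> = (\<Sum>i\<le>n. of_nat ((n - i) choose i) * (- x) ^ i)"
    by (rule sum.mono_neutral_left) (auto simp: binomial_eq_0)
  finally show ?thesis .
qed

lemma poly_rev_dickson_snd_0: "poly (rev_dickson_snd 0) x = 1"
  by (simp add: poly_rev_dickson_snd)

lemma poly_rev_dickson_snd_1: "poly (rev_dickson_snd (Suc 0)) x = 1"
  by (simp add: poly_rev_dickson_snd)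

lemma poly_rev_dickson_snd_Suc_Suc:
  "poly (rev_dickson_snd (Suc (Suc n))) x =
     poly (rev_dickson_snd (Suc n)) x - x * poly (rev_dickson_snd n) x"
proof -
  let ?c = "\<lambda>m i. of_nat (m choose i) :: 'a"
  have "poly (rev_dickson_snd (Suc (Suc n))) x
      = 1 + (\<Sum>i\<le>Suc n. ?c (Suc n - i) (Suc i) * (- x) ^ Suc i)"
    unfolding poly_rev_dickson_snd by (subst sum.atMost_Suc_shift) simp
  also have "\<dots> = 1 + (\<Sum>i\<le>n. ?c (Suc (n - i)) (Suc i) * (- x) ^ Suc i)"
    by (simp add: Suc_diff_le)
  also have "\<dots> = 1 + (\<Sum>i\<le>n. ?c (n - i) (Suc i) * (- x) ^ Suc i)
      - x * (\<Sum>i\<le>n. ?c (n - i) i * (- x) ^ i)"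
    by (simp add: algebra_simps sum.distrib sum_distrib_left sum_negf sum_subtractf)
  also have "1 + (\<Sum>i\<le>n. ?c (n - i) (Suc i) * (- x) ^ Suc i) = poly (rev_dickson_snd (Suc n)) x"
    unfolding poly_rev_dickson_snd by (subst sum.atMost_Suc_shift) simp
  also have "(\<Sum>i\<le>n. ?c (n - i) i * (- x) ^ i) = poly (rev_dickson_snd n) x"
    unfolding poly_rev_dickson_snd ..
  finally show ?thesis .
qed

text \<open>Both sides satisfy the recurrence \<open>s\<^sub>n\<^sub>+\<^sub>2 = s\<^sub>n\<^sub>+\<^sub>1 - a b s\<^sub>n\<close>, whose
  characteristic polynomial \<open>T\<^sup>2 - T + a b\<close> has the roots \<open>a\<close> and \<open>b\<close>.\<close>
lemma rev_dickson_snd_functional_equation: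
  fixes a b :: "'a :: comm_ring_1"
  assumes "a + b = 1"
  shows "(a - b) * poly (rev_dickson_snd n) (a * b) = a ^ Suc n - b ^ Suc n"
proof (induction n rule: induct_nat_012)
  case 0
  show ?case by (simp add: poly_rev_dickson_snd_0)
next
  case 1
  have "a ^ 2 - b ^ 2 = (a - b) * (a + b)"
    by (simp add: algebra_simps power2_eq_square)
  then show ?case
    by (simp add: poly_rev_dickson_snd_1 assms power2_eq_square)
next
  case (ge2 n)
  have "(a - b) * poly (rev_dickson_snd (Suc (Suc n))) (a * b)
      = (a + b) * (a ^ Suc (Suc n) - b ^ Suc (Suc n)) - a * b * (a ^ Suc n - b ^ Suc n)"
    unfolding poly_rev_dickson_snd_Suc_Suc ge2.IH(1,2)[symmetric] assms
    by (simp add: algebra_simps)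
  also have "\<dots> = a ^ Suc (Suc (Suc n)) - b ^ Suc (Suc (Suc n))"
    by (simp add: algebra_simps)
  finally show ?case .
qed

text \<open>The numbers \<open>a = u / (1 + u)\<close> and \<open>b = 1 / (1 + u)\<close> have sum 1 and
  equal \<open>(n + 1)\<close>-st powers.\<close>
lemma rev_dickson_snd_root:
  fixes u :: "'a :: field"
  assumes "u ^ (n + 1) = 1" "u \<noteq> 1" "1 + u \<noteq> 0"
  shows "poly (rev_dickson_snd n) (u / (1 + u)\<^sup>2) = 0"
proof -
  define a b where "a = u / (1 + u)" and "b = 1 / (1 + u)"
  have "a + b = 1"
    using assms(3) by (simp add: a_def b_def add.commute flip: add_divide_distrib)
  moreover have "a ^ Suc n = b ^ Suc n"
    using assms(1) by (simp add: a_def b_def power_divide)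
  moreover have "a \<noteq> b"
    using assms(2,3) by (simp add: a_def b_def)
  moreover have "a * b = u / (1 + u)\<^sup>2"
    by (simp add: a_def b_def power2_eq_square)
  ultimately show ?thesis
    using rev_dickson_snd_functional_equation[of a b n] by simp
qed

text \<open>For \<open>u \<noteq> 0\<close> the quotient is \<open>1 / (u + 1 / u + 2)\<close>, which depends only on \<open>u + 1 / u\<close>.\<close>
lemma div_square_Suc_eq_iff:
  fixes u v :: "'a :: field"
  assumes "1 + u \<noteq> 0" "1 + v \<noteq> 0"
  shows "u / (1 + u)\<^sup>2 = v / (1 + v)\<^sup>2 \<longleftrightarrow> u = v \<or> u * v = 1"
proof -
  have "u / (1 + u)\<^sup>2 = v / (1 + v)\<^sup>2 \<longleftrightarrow> u * (1 + v)\<^sup>2 = v * (1 + u)\<^sup>2"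
    using assms by (simp add: frac_eq_eq)
  also have "\<dots> \<longleftrightarrow> (u - v) * (1 - u * v) = 0"
    by (simp add: algebra_simps power2_eq_square)
  also have "\<dots> \<longleftrightarrow> u = v \<or> u * v = 1"
    by auto
  finally show ?thesis .
qed

section \<open>A finite field inside its algebraic closure\<close>

text \<open>Multiplication by \<open>x \<noteq> 0\<close> permutes the nonzero elements, so comparing their products
  gives \<open>x\<^bsup>q-1\<^esup> = 1\<close>.\<close>
lemma finite_field_power_card:
  fixes x :: "'a :: {field, finite}"
  shows "x ^ card (UNIV :: 'a set) = x"
proof (cases "x = 0")
  case False
  let ?U = "UNIV - {0 :: 'a}"
  have "(\<Prod>y\<in>?U. y) = (\<Prod>y\<in>?U. x * y)"
    by (rule prod.reindex_bij_witness[of _ "\<lambda>y. x * y" "\<lambda>y. y / x"]) (use False in auto)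
  also have "\<dots> = x ^ card ?U * (\<Prod>y\<in>?U. y)"
    by (simp add: prod.distrib)
  finally have "x ^ card ?U = 1"
    by simp
  thus ?thesis
    by (subst card.remove[OF finite_UNIV UNIV_I[of 0]]) (simp only: power_Suc mult_1_right)
qed (simp add: finite_UNIV_card_ge_0)

lemma poly_rev_dickson_snd_to_ac:
  "poly (rev_dickson_snd n) (to_ac x) = to_ac (poly (rev_dickson_snd n) x)"
  by (simp add: poly_rev_dickson_snd to_ac_sum)

text \<open>The polynomial \<open>X\<^sup>q - X\<close> has at most \<open>q\<close> roots, and the \<open>q\<close> elements of the field are
  already among them.\<close>
lemma fixed_by_Frobenius_in_range_to_ac:
  fixes z :: "'a :: {field, finite} alg_closure"
  assumes "z ^ card (UNIV :: 'a set) = z"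
  shows "z \<in> range to_ac"
proof -
  define q where "q = card (UNIV :: 'a set)"
  define P :: "'a alg_closure poly" where "P = monom 1 q - monom 1 1"
  have "card {0, 1 :: 'a} \<le> q"
    unfolding q_def by (rule card_mono) auto
  hence "q \<ge> 2"
    by simp
  hence "coeff P q = 1"
    by (simp add: P_def)
  hence "P \<noteq> 0"
    by auto
  have "degree P \<le> q"
    unfolding P_def using \<open>q \<ge> 2\<close> by (intro degree_diff_le) (auto simp: degree_monom_eq)
  have roots: "{x. poly P x = 0} = {x. x ^ q = x}"
    by (auto simp: P_def poly_monom)
  have "range to_ac = {x :: 'a alg_closure. x ^ q = x}"
  proof (rule card_seteq)
    show "finite {x :: 'a alg_closure. x ^ q = x}"
      using poly_roots_finite[OF \<open>P \<noteq> 0\<close>] roots by simp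
    show "range to_ac \<subseteq> {x :: 'a alg_closure. x ^ q = x}"
      by (auto simp: q_def finite_field_power_card simp flip: to_ac_power)
    have "card {x :: 'a alg_closure. x ^ q = x} \<le> degree P"
      using card_poly_roots_bound[OF \<open>P \<noteq> 0\<close>] roots by simp
    also have "\<dots> \<le> q" by fact
    also have "q = card (range to_ac :: 'a alg_closure set)"
      by (simp add: q_def card_image inj_to_ac)
    finally show "card {x :: 'a alg_closure. x ^ q = x} \<le> card (range to_ac :: 'a alg_closure set)" .
  qed
  with assms show ?thesis
    by (auto simp: q_def)
qed

section \<open>Roots of unity\<close>

text \<open>Take for \<open>u\<close> a root of \<open>1 + X + \<dots> + X\<^bsup>m-1\<^esup>\<close>; the value of this polynomial at 1
  is \<open>m\<close>, so 1 is not a root.\<close>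
lemma ex_nontrivial_root_of_unity:
  assumes "m > 1" "of_nat m \<noteq> (0 :: 'a :: alg_closed_field)"
  obtains u :: "'a :: alg_closed_field" where "u ^ m = 1" "u \<noteq> 1"
proof -
  from assms obtain u :: 'a where u: "(\<Sum>k\<le>m - 1. 1 * u ^ k) = 0"
    using alg_closed[of "m - 1" "\<lambda>_. 1 :: 'a"] by auto
  have "{..m - 1} = {..<m}"
    using assms by auto
  with u have sum0: "(\<Sum>k<m. u ^ k) = 0"
    by simp
  have "u ^ m - 1 = (u - 1) * (\<Sum>k<m. u ^ k)"
    by (rule power_diff_1_eq)
  with sum0 have "u ^ m = 1"
    by simp
  moreover have "u \<noteq> 1"
    using sum0 assms by auto
  ultimately show ?thesis
    using that by blast
qed

lemma power_eq_1_dvd: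
  fixes u :: "'a :: monoid_mult"
  assumes "u ^ l = 1" "l dvd m"
  shows "u ^ m = 1"
  using assms by (auto simp: power_mult)

text \<open>For \<open>u = -1\<close> and odd \<open>l\<close>, the power \<open>u\<^sup>l\<close> is \<open>-1\<close>, which differs from 1.\<close>
lemma odd_root_of_unity_Suc_nonzero:
  fixes u :: "'a :: field"
  assumes "u ^ l = 1" "odd l" "(2 :: 'a) \<noteq> 0"
  shows "1 + u \<noteq> 0"
proof
  assume "1 + u = 0"
  hence "u = - 1"
    by (simp add: eq_neg_iff_add_eq_0 add.commute)
  with assms(1,2) have "(1 :: 'a) + 1 = 0"
    by (metis power_minus_odd power_one add.right_inverse)
  with assms(3) show False
    by simp
qed

text \<open>The Frobenius map sends \<open>u\<close> to \<open>u\<close> or to \<open>1 / u\<close>, according to which of \<open>q - 1\<close> and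
  \<open>q + 1\<close> the prime \<open>l\<close> divides.\<close>
lemma root_of_unity_quotient_in_range_to_ac:
  fixes u :: "'a :: {field, finite} alg_closure"
  assumes q: "q = card (UNIV :: 'a set)" "q = CHAR('a) ^ e" "prime CHAR('a)"
    and l: "prime l" "l dvd q\<^sup>2 - 1"
    and u: "u ^ l = 1" "1 + u \<noteq> 0"
  shows "u / (1 + u)\<^sup>2 \<in> range to_ac"
proof -
  have q_pos: "q > 0"
    using q(1) by (simp add: finite_UNIV_card_ge_0)
  have "u \<noteq> 0"
    using u(1) l(1) by (auto simp: power_0_left dest: prime_gt_0_nat)
  have frob: "(1 + u) ^ q = 1 + u ^ q"
    using freshmans_dream'[of q e 1 u] q(2,3) by simp
  have "q\<^sup>2 - 1 = (q - 1) * (q + 1)"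
    by (simp add: algebra_simps power2_eq_square)
  with l(2) have "l dvd (q - 1) * (q + 1)"
    by simp
  with l(1) consider "l dvd q - 1" | "l dvd q + 1"
    using prime_dvd_multD by blast
  hence conj: "u ^ q = u \<or> u ^ q * u = 1"
  proof cases
    case 1
    hence "u ^ (q - 1) = 1"
      using u(1) power_eq_1_dvd by blast
    moreover have "u ^ q = u ^ (q - 1) * u"
      using q_pos by (cases q) auto
    ultimately show ?thesis
      by simp
  next
    case 2
    hence "u ^ (q + 1) = 1"
      using u(1) power_eq_1_dvd by blast
    thus ?thesis
      by (simp add: mult.commute)
  qed
  have "1 + u ^ q \<noteq> 0"
    using u(2) by (simp flip: frob)
  hence "u ^ q / (1 + u ^ q)\<^sup>2 = u / (1 + u)\<^sup>2"
    using u(2) conj div_square_Suc_eq_iff by blast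
  moreover have "((1 + u)\<^sup>2) ^ q = (1 + u ^ q)\<^sup>2"
    unfolding frob[symmetric] by (simp only: power_mult[symmetric] mult.commute)
  ultimately have "(u / (1 + u)\<^sup>2) ^ q = u / (1 + u)\<^sup>2"
    by (simp only: power_divide)
  thus ?thesis
    unfolding q(1) by (rule fixed_by_Frobenius_in_range_to_ac)
qed

text \<open>As \<open>k\<close> is prime to \<open>l\<close>, Bezout expresses \<open>u\<close> through \<open>u\<^sup>k\<close> and \<open>u\<^sup>l\<close>, so both
  cannot be 1.\<close>
lemma prime_root_of_unity_small_power:
  fixes u :: "'a :: field"
  assumes "prime l" "u ^ l = 1" "u \<noteq> 1" "0 < k" "k < l"
  shows "u ^ k \<noteq> 1"
proof
  assume k: "u ^ k = 1"
  have "\<not> l dvd k"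
    using assms(4,5) by (auto dest: dvd_imp_le)
  hence "coprime k l"
    using assms(1) prime_imp_coprime coprime_commute by blast
  hence "gcd k l = 1"
    by simp
  with bezout_nat[of k l] assms(4) obtain a b where "k * a = l * b + 1"
    by auto
  hence "u ^ (k * a) = u ^ (l * b + 1)"
    by (simp only:)
  hence "(u ^ k) ^ a = (u ^ l) ^ b * u"
    by (simp only: power_mult power_add power_one_right)
  with k assms(2,3) show False
    by simp
qed

section \<open>Permutation polynomials\<close>

text \<open>Half of \<open>gcd N M\<close> is odd, prime to 3, and different from 1.\<close>
lemma ex_prime_factor_ge_5:
  fixes N M :: nat
  assumes "[N = 2] (mod 4)" "\<not> 3 dvd N" "even M" "gcd N M \<noteq> 2"
  obtains l where "prime l" "l \<ge> 5" "l dvd N" "l dvd M"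
proof -
  have N: "N mod 4 = 2"
    using assms(1) by (simp add: cong_def)
  hence "even N"
    by presburger
  with assms(3) obtain m where m: "gcd N M = 2 * m"
    by (meson dvdE gcd_greatest)
  with assms(4) have "m \<noteq> 1"
    by auto
  then obtain l where l: "prime l" "l dvd m"
    using prime_factor_nat by blast
  have "2 * l dvd gcd N M"
    using l(2) m by simp
  hence "2 * l dvd N" "2 * l dvd M"
    by auto
  hence dvd: "l dvd N" "l dvd M"
    using dvd_mult_right by blast+
  have "l \<noteq> 2"
    using \<open>2 * l dvd N\<close> N by (auto simp: mod_eq_0_iff_dvd[symmetric])
  moreover have "l \<noteq> 3"
    using dvd assms(2) by auto
  moreover have "l \<noteq> 4"
    using l(1) prime_nat_iff[of 4] by (auto dest: spec[of _ 2])
  moreover have "l \<ge> 2"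
    using l(1) by (rule prime_ge_2_nat)
  ultimately have "l \<ge> 5"
    by linarith
  thus ?thesis
    using that l(1) dvd by blast
qed

lemma CHAR_eq_if_card_prime_power:
  assumes "prime p" "card (UNIV :: 'a :: {field, finite} set) = p ^ e"
  shows "CHAR('a) = p"
proof -
  have "prime CHAR('a)"
    by (rule prime_CHAR_semidom) (simp add: finite_imp_CHAR_pos)
  moreover have "CHAR('a) dvd p ^ e"
    using CHAR_dvd_CARD[where ?'a = 'a] assms(2) by simp
  ultimately show ?thesis
    using assms(1) by (metis prime_dvd_power primes_dvd_imp_eq)
qed

theorem theorem3p5:
  fixes p e q n :: nat
  assumes "prime p" and "odd p" and "p > 3"
    and "e \<ge> 1" and "q = p ^ e"
    and "card (UNIV :: 'a :: {field, finite} set) = q"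
    and "\<not> 3 dvd (n + 1)"
    and "[n = 1] (mod 4)"
    and "permutation_poly (rev_dickson_snd n :: 'a poly)"
  shows "gcd (n + 1) (q\<^sup>2 - 1) = 2"
proof (rule ccontr)
  let ?f = "\<lambda>u :: 'a alg_closure. u / (1 + u)\<^sup>2"
  assume neq: "gcd (n + 1) (q\<^sup>2 - 1) \<noteq> 2"
  have CHAR: "CHAR('a) = p"
    using assms by (intro CHAR_eq_if_card_prime_power) auto
  have "[n + 1 = 2] (mod 4)"
    using cong_add[OF assms(8) cong_refl[of 1 4]] by (simp only: one_add_one)
  moreover have "even (q\<^sup>2 - 1)"
    using assms(2,5) by simp
  ultimately obtain l where l: "prime l" "l \<ge> 5" "l dvd n + 1" "l dvd q\<^sup>2 - 1"
    using ex_prime_factor_ge_5 neq assms(7) by metis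
  have "odd l"
    using l(1,2) prime_odd_nat by auto
  \<comment> \<open>In characteristic \<open>l\<close> the only \<open>l\<close>-th root of unity would be 1.\<close>
  have "\<not> p dvd l"
  proof
    assume "p dvd l"
    hence "p dvd q\<^sup>2 - 1"
      using l(4) dvd_trans by blast
    moreover have "p dvd q\<^sup>2"
      using assms(4,5) by (simp add: dvd_power flip: power_mult)
    moreover have "q\<^sup>2 \<ge> 1"
      using assms(1,5) by (simp add: prime_gt_0_nat Suc_le_eq)
    ultimately have "p dvd 1"
      by (metis dvd_diffD1)
    with assms(1) show False
      by simp
  qed
  hence "of_nat l \<noteq> (0 :: 'a alg_closure)"
    by (simp add: of_nat_eq_0_iff_char_dvd CHAR)
  then obtain u :: "'a alg_closure" where u: "u ^ l = 1" "u \<noteq> 1"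
    using ex_nontrivial_root_of_unity[of l] l(2) by auto
  have u2: "(u\<^sup>2) ^ l = 1"
    using power_eq_1_dvd[OF u(1), of "2 * l"] by (simp only: power_mult dvd_triv_right)
  have two: "(2 :: 'a alg_closure) \<noteq> 0"
  proof
    assume "(2 :: 'a alg_closure) = 0"
    hence "of_nat 2 = (0 :: 'a alg_closure)"
      by simp
    hence "p dvd 2"
      unfolding of_nat_eq_0_iff_char_dvd by (simp add: CHAR)
    with \<open>p > 3\<close> show False
      by (auto dest: dvd_imp_le)
  qed
  have nz: "1 + u \<noteq> 0" "1 + u\<^sup>2 \<noteq> 0"
    using odd_root_of_unity_Suc_nonzero \<open>odd l\<close> two u(1) u2 by blast+
  have "u \<noteq> 0"
    using u(1) l(2) by (auto simp: power_0_left)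
  have "u\<^sup>2 \<noteq> 1" "u ^ 3 \<noteq> 1"
    using prime_root_of_unity_small_power[OF l(1) u] l(2) by auto
  have root: "\<exists>x. to_ac x = ?f v \<and> poly (rev_dickson_snd n) x = (0 :: 'a)"
    if v: "v ^ l = 1" "v \<noteq> 1" "1 + v \<noteq> 0" for v
  proof -
    have "?f v \<in> range to_ac"
      using root_of_unity_quotient_in_range_to_ac[OF assms(6)[symmetric] _ _ l(1,4) v(1,3), of e]
        assms(1,5) by (simp add: CHAR)
    then obtain x where x: "to_ac x = ?f v"
      by auto
    have "v ^ (n + 1) = 1"
      using power_eq_1_dvd v(1) l(3) by blast
    hence "to_ac (poly (rev_dickson_snd n) x) = 0"
      unfolding poly_rev_dickson_snd_to_ac[symmetric] x using v by (intro rev_dickson_snd_root)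
    with x show ?thesis
      by (intro exI[of _ x]) simp
  qed
  obtain x where x: "to_ac x = ?f u" "poly (rev_dickson_snd n) x = (0 :: 'a)"
    using root[OF u nz(1)] by blast
  obtain y where y: "to_ac y = ?f (u\<^sup>2)" "poly (rev_dickson_snd n) y = (0 :: 'a)"
    using root[OF u2 \<open>u\<^sup>2 \<noteq> 1\<close> nz(2)] by blast
  have "inj (poly (rev_dickson_snd n :: 'a poly))"
    using assms(9) by (simp add: permutation_poly_def bij_is_inj)
  hence "x = y"
    by (rule injD) (simp only: x(2) y(2))
  hence "?f u = ?f (u\<^sup>2)"
    using x(1) y(1) by simp
  hence "u = u\<^sup>2 \<or> u * u\<^sup>2 = 1"
    using div_square_Suc_eq_iff nz by blast
  thus False
    using u(2) \<open>u \<noteq> 0\<close> \<open>u ^ 3 \<noteq> 1\<close> by (simp add: power2_eq_square power3_eq_cube mult.assoc)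
qed

end
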